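(* There exist a function $g_1$ in $H^\infty(\mathbb{D})$ and a function $g_2$ in $\mathrm{BMOA}(\mathbb{D})$ such that $T_{g_1\otimes g_2}$ is unbounded on $H^2(\mathbb{D}^2)$.
   Context: $\mathbb{D}$ is the unit disc and $(g_1\otimes g_2)(z,w)=g_1(z)g_2(w)$. On functions of two variables holomorphic in $\mathbb{D}^2$, the radial differentiation operator is $Rf(z,w)=z\,\partial_zf(z,w)+w\,\partial_wf(z,w)$, so that $R\big(\sum_{m,n\ge0}a_{m,n}z^mw^n\big)=\sum_{m,n\ge0}(m+n)a_{m,n}z^mw^n$, and radial integration is $R^{-1}\big(\sum_{m,n\ge0}a_{m,n}z^mw^n\big)=\sum_{m,n\ge0,\,m+n>0}\frac{a_{m,n}}{m+n}z^mw^n$. The radial Volterra operator with symbol $g$ is $T_gf=R^{-1}(f\,Rg)$. It is bounded on $H^2(\mathbb{D}^2)$ if it maps $H^2(\mathbb{D}^2)$ into itself with finite operator norm, and unbounded otherwise, where $\big\|\sum a_{m,n}z^mw^n\big\|_{H^2(\mathbb{D}^2)}^2=\sum|a_{m,n}|^2$. *)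

theory Defs
  imports "HOL-Analysis.Analysis"
begin

text \<open>Functions on the disc or the bidisc are total functions; only their values on
  the open disc or bidisc are relevant.\<close>

abbreviation unit_disc :: "complex set" where
  "unit_disc \<equiv> ball 0 1"

abbreviation bidisc :: "(complex \<times> complex) set" where
  "bidisc \<equiv> unit_disc \<times> unit_disc"


definition holomorphic_bidisc :: "(complex \<times> complex \<Rightarrow> complex) \<Rightarrow> bool" where
  "holomorphic_bidisc f \<longleftrightarrow>
     (\<forall>p\<in>bidisc. \<exists>a b. (f has_derivative (\<lambda>(h, k). a * h + b * k)) (at p))"

text \<open>The coefficient of \<open>z ^ m * w ^ n\<close> in the Taylor expansion at the origin.\<close>

definition taylor_coeff2 :: "(complex \<times> complex \<Rightarrow> complex) \<Rightarrow> nat \<Rightarrow> nat \<Rightarrow> complex" where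
  "taylor_coeff2 f m n =
     (deriv ^^ m) (\<lambda>z. (deriv ^^ n) (\<lambda>w. f (z, w)) 0) 0 / (fact m * fact n)"

definition hardy2_bidisc :: "(complex \<times> complex \<Rightarrow> complex) set" where
  "hardy2_bidisc =
     {f. holomorphic_bidisc f \<and> (\<lambda>(m, n). (norm (taylor_coeff2 f m n))\<^sup>2) summable_on UNIV}"

definition hardy2_bidisc_norm :: "(complex \<times> complex \<Rightarrow> complex) \<Rightarrow> real" where
  "hardy2_bidisc_norm f = sqrt (\<Sum>\<^sub>\<infinity>(m, n)\<in>UNIV. (norm (taylor_coeff2 f m n))\<^sup>2)"


definition radial_diff :: "(complex \<times> complex \<Rightarrow> complex) \<Rightarrow> complex \<times> complex \<Rightarrow> complex" where
  "radial_diff f = (\<lambda>(z, w). z * deriv (\<lambda>u. f (u, w)) z + w * deriv (\<lambda>v. f (z, v)) w)"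

definition radial_int :: "(complex \<times> complex \<Rightarrow> complex) \<Rightarrow> complex \<times> complex \<Rightarrow> complex" where
  "radial_int f = (\<lambda>(z, w).
     \<Sum>\<^sub>\<infinity>(m, n)\<in>{(m, n). m + n > 0}. taylor_coeff2 f m n / of_nat (m + n) * z ^ m * w ^ n)"

definition radial_volterra ::
    "(complex \<times> complex \<Rightarrow> complex) \<Rightarrow> (complex \<times> complex \<Rightarrow> complex)
      \<Rightarrow> complex \<times> complex \<Rightarrow> complex" where
  "radial_volterra g f = radial_int (\<lambda>p. f p * radial_diff g p)"

definition bounded_on_hardy2_bidisc ::
    "((complex \<times> complex \<Rightarrow> complex) \<Rightarrow> (complex \<times> complex \<Rightarrow> complex)) \<Rightarrow> bool" where
  "bounded_on_hardy2_bidisc T \<longleftrightarrow>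
     (\<forall>f\<in>hardy2_bidisc. T f \<in> hardy2_bidisc) \<and>
     (\<exists>C. \<forall>f\<in>hardy2_bidisc. hardy2_bidisc_norm (T f) \<le> C * hardy2_bidisc_norm f)"

definition tensor_fun ::
    "(complex \<Rightarrow> complex) \<Rightarrow> (complex \<Rightarrow> complex) \<Rightarrow> complex \<times> complex \<Rightarrow> complex"
    (infixr "\<otimes>\<^sub>f" 75) where
  "g1 \<otimes>\<^sub>f g2 = (\<lambda>(z, w). g1 z * g2 w)"


definition hardy_inf_disc :: "(complex \<Rightarrow> complex) set" where
  "hardy_inf_disc = {g. g holomorphic_on unit_disc \<and> bounded (g ` unit_disc)}"

definition hardy2_disc :: "(complex \<Rightarrow> complex) set" where
  "hardy2_disc = {g. g holomorphic_on unit_disc \<and>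
     summable (\<lambda>n. (norm ((deriv ^^ n) g 0 / fact n))\<^sup>2)}"

text \<open>Bounded mean oscillation on the unit circle: an integrable function \<open>\<phi>\<close> whose mean
  oscillation over the arc from \<open>cis a\<close> to \<open>cis b\<close> is bounded uniformly in the arc.\<close>

definition circle_mean :: "(complex \<Rightarrow> complex) \<Rightarrow> real \<Rightarrow> real \<Rightarrow> complex" where
  "circle_mean \<phi> a b = (LBINT t:{a..b}. \<phi> (cis t)) / of_real (b - a)"

definition bmo_circle :: "(complex \<Rightarrow> complex) set" where
  "bmo_circle = {\<phi>. set_integrable lborel {0..2 * pi} (\<lambda>t. \<phi> (cis t)) \<and>
     (\<exists>M. \<forall>a b. a < b \<and> b \<le> a + 2 * pi \<longrightarrow>
        (LBINT t:{a..b}. norm (\<phi> (cis t) - circle_mean \<phi> a b)) / (b - a) \<le> M)}"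

text \<open>BMOA: the functions in the Hardy space \<open>H\<^sup>2\<close> of the disc whose boundary function, given
  almost everywhere by radial limits, has bounded mean oscillation.  The Hardy space
  condition cannot be dropped: \<open>exp ((1 + z) / (1 - z))\<close> has unimodular radial limits almost
  everywhere.\<close>

definition bmoa_disc :: "(complex \<Rightarrow> complex) set" where
  "bmoa_disc = {g \<in> hardy2_disc. \<exists>\<phi>\<in>bmo_circle.
     AE t in lborel. ((\<lambda>r. g (of_real r * cis t)) \<longlongrightarrow> \<phi> (cis t)) (at_left 1)}"

end

theory Submission
  imports Defs "HOL-Complex_Analysis.Complex_Analysis"
begin

text \<open>Take \<open>g\<^sub>2(w) = - log (1 - w)\<close> and the very sparse \<open>g\<^sub>1(z) = (\<Sum>k. 2\<^sup>-\<^sup>k z ^ M k)\<close> with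
  \<open>M k = 2 * 2 ^ (4 ^ k)\<close>, and test on \<open>f(w) = 1 + w + \<dots> + w ^ (N - 1)\<close> with \<open>N = M k\<close>.
  The coefficient of \<open>z ^ N * w ^ n\<close>, \<open>n < N\<close>, in the image of \<open>f\<close> is at least half of \<open>2\<^sup>-\<^sup>k\<close>
  times the \<open>n\<close>-th harmonic number, because division by \<open>N + n \<le> 2 * N\<close> does not destroy the
  factor \<open>N\<close> gained by differentiating \<open>z ^ N\<close>.  Hence the operator norm is at least of order
  \<open>2\<^sup>-\<^sup>k log N\<close>, which is of order \<open>2 ^ k\<close>.  That \<open>g\<^sub>2\<close> has bounded mean oscillation comes from
  \<open>log |1 - exp (i t)| = log |t| + O(1)\<close> near \<open>0\<close> and the integrability of the logarithm.\<close>

section \<open>Power series on the disc and the bidisc\<close>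

text \<open>Coefficients and function are carried together, so that Taylor coefficients can be read
  off from products and derivatives instead of being computed by repeated differentiation.\<close>

definition disc_series :: "(nat \<Rightarrow> complex) \<Rightarrow> (complex \<Rightarrow> complex) \<Rightarrow> bool" where
  "disc_series c h \<longleftrightarrow> (\<forall>z\<in>unit_disc. (\<lambda>n. c n * z ^ n) sums h z)"

lemma disc_series_holomorphic:
  assumes "disc_series c h"
  shows "h holomorphic_on unit_disc"
  using assms power_series_holomorphic[of 0 1 c h] by (auto simp: disc_series_def)

lemma disc_series_summable_norm:
  assumes "disc_series c h" and z: "norm z < 1"
  shows "summable (\<lambda>n. norm (c n * z ^ n))"
proof (rule powser_insidea)
  define x :: complex where "x = of_real ((1 + norm z) / 2)"
  have nx: "norm x = (1 + norm z) / 2"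
    unfolding x_def norm_of_real by simp
  show "norm z < norm x" using z nx by simp
  have "x \<in> unit_disc" using z nx by simp
  then show "summable (\<lambda>n. c n * x ^ n)"
    using assms(1) by (auto simp: disc_series_def summable_def)
qed

lemma disc_series_has_sum:
  assumes "disc_series c h" and "norm z < 1"
  shows "((\<lambda>n. c n * z ^ n) has_sum h z) UNIV"
  using norm_summable_imp_has_sum[OF disc_series_summable_norm[OF assms]] assms
  by (simp add: disc_series_def)

lemma disc_series_coeff:
  assumes "disc_series c h"
  shows "(deriv ^^ n) h 0 / fact n = c n"
proof -
  have "\<forall>\<^sub>F z in nhds 0. (\<lambda>n. fps_nth (Abs_fps c) n * z ^ n) sums h z"
    using assms eventually_nhds_in_open[of unit_disc 0]
    by (auto simp: disc_series_def elim!: eventually_mono)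
  then have "h has_fps_expansion Abs_fps c" by (rule has_fps_expansionI)
  from fps_nth_fps_expansion[OF this, of n] show ?thesis by simp
qed

text \<open>Termwise differentiation is valid on a disc of radius \<open>r\<close> strictly between
  \<open>norm z\<close> and 1. There the function supplied by the power series theorem agrees with
  \<open>h\<close>, so the two have the same derivative at \<open>z\<close>.\<close>

lemma disc_series_euler:
  assumes "disc_series c h"
  shows "disc_series (\<lambda>n. of_nat n * c n) (\<lambda>z. z * deriv h z)"
  unfolding disc_series_def
proof
  fix z :: complex assume z: "z \<in> unit_disc"
  define r where "r = (1 + norm z) / 2"
  have r: "norm z < r" "0 < r" "r < 1" using z by (auto simp: r_def add_pos_nonneg)
  then have "of_real r \<in> unit_disc" by simp
  then have "summable (\<lambda>n. c n * of_real r ^ n)"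
    using assms by (auto simp: disc_series_def summable_def)
  then obtain g g' where g: "\<And>w. norm w < r \<Longrightarrow> ((\<lambda>n. c n * w^n) sums g w) \<and>
        ((\<lambda>n. of_nat n * c n * w^(n-1)) sums g' w) \<and> (g has_field_derivative g' w) (at w)"
    using power_series_and_derivative_0[of c r] by auto
  have gh: "g w = h w" if "norm w < r" for w
    using g[OF that] assms that r by (auto simp: disc_series_def intro: sums_unique2)
  have "(h has_field_derivative g' z) (at z)"
  proof (rule has_field_derivative_transform_within_open[of g])
    show "(g has_field_derivative g' z) (at z)" using g r by blast
    show "z \<in> ball 0 r" using r by simp
  qed (auto simp: gh)
  then have "deriv h z = g' z" by (rule DERIV_imp_deriv)
  moreover have "(\<lambda>n. z * (of_nat n * c n * z^(n-1))) sums (z * g' z)"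
    using g[OF r(1)] by (intro sums_mult) auto
  \<comment> \<open>The truncated exponent \<open>n - 1\<close> does no harm at
    \<open>n = 0\<close>, where both sides vanish.\<close>
  moreover have "z * (of_nat n * c n * z^(n-1)) = of_nat n * c n * z ^ n" for n
    by (cases n) auto
  ultimately show "(\<lambda>n. of_nat n * c n * z ^ n) sums (z * deriv h z)" by (simp only:)
qed

lemma disc_series_mult:
  assumes "disc_series a f" "disc_series b g"
  shows "disc_series (\<lambda>n. \<Sum>i\<le>n. a i * b (n - i)) (\<lambda>z. f z * g z)"
  unfolding disc_series_def
proof
  fix z :: complex assume z: "z \<in> unit_disc"
  have "(\<lambda>k. \<Sum>i\<le>k. (a i * z ^ i) * (b (k - i) * z ^ (k - i)))
          sums ((\<Sum>k. a k * z ^ k) * (\<Sum>k. b k * z ^ k))"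
    using z by (intro Cauchy_product_sums disc_series_summable_norm[OF assms(1)]
      disc_series_summable_norm[OF assms(2)]) auto
  moreover have "(\<Sum>k. a k * z ^ k) = f z" "(\<Sum>k. b k * z ^ k) = g z"
    using assms z by (auto simp: disc_series_def sums_iff)
  moreover have "(\<Sum>i\<le>k. (a i * z ^ i) * (b (k - i) * z ^ (k - i))) = (\<Sum>i\<le>k. a i * b (k - i)) * z ^ k" for k
    unfolding sum_distrib_right
  proof (rule sum.cong[OF refl])
    fix i assume "i \<in> {..k}"
    then have "z ^ k = z ^ i * z ^ (k - i)" by (simp flip: power_add)
    then show "(a i * z ^ i) * (b (k - i) * z ^ (k - i)) = a i * b (k - i) * z ^ k" by simp
  qed
  ultimately show "(\<lambda>n. (\<Sum>i\<le>n. a i * b (n - i)) * z ^ n) sums (f z * g z)" by simp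
qed

section \<open>Double power series: Taylor coefficients, tensor products and radial
  integration\<close>

definition bidisc_series :: "(nat \<Rightarrow> nat \<Rightarrow> complex) \<Rightarrow> (complex \<times> complex \<Rightarrow> complex) \<Rightarrow> bool" where
  "bidisc_series c F \<longleftrightarrow>
     (\<forall>(z, w)\<in>bidisc. ((\<lambda>(m, n). c m n * z ^ m * w ^ n) has_sum F (z, w)) UNIV)"

text \<open>Unordered summability permits grouping the double series by powers of \<open>w\<close>.
  Uniqueness of one-variable coefficients then applies twice: first in \<open>w\<close>, where the
  coefficients are the functions \<open>C n\<close>, and then in \<open>z\<close>.\<close>

lemma bidisc_series_coeff:
  assumes "bidisc_series c F"
  shows "taylor_coeff2 F m n = c m n"
proof -
  have hs: "((\<lambda>(m, n). c m n * z ^ m * w ^ n) has_sum F (z, w)) UNIV"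
    if "norm z < 1" "norm w < 1" for z w
    using assms that by (auto simp: bidisc_series_def)
  define C where "C n z = (\<Sum>\<^sub>\<infinity>m. c m n * z ^ m)" for n z
  have C: "((\<lambda>m. c m n * z ^ m) has_sum C n z) UNIV" if z: "norm z < 1" for n z
  proof -
    \<comment> \<open>Any nonzero value of \<open>w\<close> in the disc would do in place of 1/2:
      the factor \<open>(1/2) ^ n\<close> has to be cancelled afterwards.\<close>
    have "(\<lambda>(n, m). c m n * z ^ m * (1/2) ^ n) summable_on UNIV \<times> UNIV"
      using has_sum_imp_summable[OF hs[OF z, of "1/2"]]
        summable_on_swap[of "\<lambda>(m, n). c m n * z ^ m * (1/2) ^ n" UNIV UNIV]
      by simp
    then have "(\<lambda>m. c m n * z ^ m * (1/2) ^ n) summable_on UNIV"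
      by (rule summable_on_SigmaD1) simp
    then have "(\<lambda>m. c m n * z ^ m) summable_on UNIV"
      by (subst (asm) summable_on_cmult_left') auto
    then show ?thesis unfolding C_def by (rule has_sum_infsum)
  qed
  have F: "((\<lambda>n. C n z * w ^ n) has_sum F (z, w)) UNIV" if "norm z < 1" "norm w < 1" for z w
  proof (rule has_sum_SigmaD)
    show "((\<lambda>(n, m). c m n * z ^ m * w ^ n) has_sum F (z, w)) (UNIV \<times> UNIV)"
      using hs[OF that] has_sum_swap[of "\<lambda>(m, n). c m n * z ^ m * w ^ n" UNIV UNIV] by simp
    show "((\<lambda>m. case (n, m) of (n, m) \<Rightarrow> c m n * z ^ m * w ^ n) has_sum C n z * w ^ n) UNIV" for n
      using has_sum_cmult_left[OF C[OF that(1)], of n "w ^ n"] by simp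
  qed
  have "disc_series (\<lambda>n. C n z) (\<lambda>w. F (z, w))" if "norm z < 1" for z
    using F[OF that] by (auto simp: disc_series_def intro: has_sum_imp_sums)
  then have 1: "(deriv ^^ n) (\<lambda>w. F (z, w)) 0 / fact n = C n z" if "norm z < 1" for z
    using that disc_series_coeff by blast
  have "disc_series (\<lambda>m. fact n * c m n) (\<lambda>z. (deriv ^^ n) (\<lambda>w. F (z, w)) 0)"
    unfolding disc_series_def
  proof
    fix z :: complex assume "z \<in> unit_disc"
    then have z: "norm z < 1" by simp
    have "(\<lambda>m. fact n * (c m n * z ^ m)) sums (fact n * C n z)"
      using C[OF z] by (intro sums_mult has_sum_imp_sums)
    then show "(\<lambda>m. fact n * c m n * z ^ m) sums (deriv ^^ n) (\<lambda>w. F (z, w)) 0"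
      using 1[OF z] by (simp add: field_simps)
  qed
  from disc_series_coeff[OF this, of m]
  show ?thesis by (simp add: taylor_coeff2_def field_simps)
qed

text \<open>Summable complex families are absolutely summable, so the product family is absolutely
  summable on the product set and can be summed one index at a time.\<close>

lemma has_sum_prod_mult:
  fixes a b :: "nat \<Rightarrow> complex"
  assumes a: "(a has_sum A) UNIV" and b: "(b has_sum B) UNIV"
  shows "((\<lambda>(m, n). a m * b n) has_sum A * B) UNIV"
proof -
  have sb: "(\<lambda>n. norm (b n)) summable_on UNIV" and sa: "(\<lambda>m. norm (a m)) summable_on UNIV"
    using a b summable_on_iff_abs_summable_on_complex by (auto simp: summable_on_def)
  have "(\<lambda>p. norm (case p of (m, n) \<Rightarrow> a m * b n)) summable_on UNIV \<times> UNIV"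
    unfolding Infinite_Sum.abs_summable_on_Sigma_iff
    using summable_on_cmult_right[OF sb] summable_on_cmult_left[OF sa]
    by (auto simp: norm_mult infsum_cmult_right' abs_mult infsum_nonneg)
  then have "(\<lambda>(m, n). a m * b n) summable_on UNIV \<times> UNIV"
    by (rule abs_summable_summable)
  then have "((\<lambda>(m, n). a m * b n) has_sum A * B) (UNIV \<times> UNIV)"
    using has_sum_cmult_right[OF b] has_sum_cmult_left[OF a]
    by (intro has_sum_SigmaI[where g = "\<lambda>m. a m * B"]) auto
  then show ?thesis by simp
qed

lemma bidisc_series_tensor:
  assumes "disc_series a f" "disc_series b g"
  shows "bidisc_series (\<lambda>m n. a m * b n) (f \<otimes>\<^sub>f g)"
  unfolding bidisc_series_def
proof clarify
  fix z w :: complex assume "z \<in> unit_disc" "w \<in> unit_disc"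
  then have "((\<lambda>(m, n). (a m * z ^ m) * (b n * w ^ n)) has_sum f z * g w) UNIV"
    by (intro has_sum_prod_mult disc_series_has_sum assms) auto
  then show "((\<lambda>(m, n). a m * b n * z ^ m * w ^ n) has_sum (f \<otimes>\<^sub>f g) (z, w)) UNIV"
    by (simp add: tensor_fun_def ac_simps)
qed

lemma bidisc_series_add:
  assumes "bidisc_series c F" "bidisc_series d G"
  shows "bidisc_series (\<lambda>m n. c m n + d m n) (\<lambda>p. F p + G p)"
  unfolding bidisc_series_def
proof clarify
  fix z w :: complex assume "z \<in> unit_disc" "w \<in> unit_disc"
  then have "((\<lambda>p. (case p of (m, n) \<Rightarrow> c m n * z ^ m * w ^ n) + (case p of (m, n) \<Rightarrow> d m n * z ^ m * w ^ n))
      has_sum F (z, w) + G (z, w)) UNIV"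
    using assms by (intro has_sum_add) (auto simp: bidisc_series_def)
  then show "((\<lambda>(m, n). (c m n + d m n) * z ^ m * w ^ n) has_sum F (z, w) + G (z, w)) UNIV"
    by (simp add: case_prod_unfold algebra_simps)
qed

lemma bidisc_series_cong:
  assumes "bidisc_series c F" "\<And>p. p \<in> bidisc \<Longrightarrow> F p = G p"
  shows "bidisc_series c G"
  using assms unfolding bidisc_series_def by fastforce

text \<open>The constant term \<open>c 0 0 / 0\<close> is \<open>0\<close> by convention, as required by \<open>R\<^sup>-\<^sup>1\<close>.\<close>

lemma bidisc_series_radial_int:
  assumes "bidisc_series c F"
  shows "bidisc_series (\<lambda>m n. c m n / of_nat (m + n)) (radial_int F)"
  unfolding bidisc_series_def
proof clarify
  fix z w :: complex assume "z \<in> unit_disc" "w \<in> unit_disc"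
  then have "((\<lambda>(m, n). c m n * z ^ m * w ^ n) has_sum F (z, w)) UNIV"
    using assms by (auto simp: bidisc_series_def)
  then have "(\<lambda>(m, n). c m n * z ^ m * w ^ n) summable_on UNIV"
    by (rule has_sum_imp_summable)
  then have "(\<lambda>p. norm (case p of (m, n) \<Rightarrow> c m n * z ^ m * w ^ n)) summable_on UNIV"
    by (simp add: summable_on_iff_abs_summable_on_complex)
  then have "(\<lambda>p. norm (case p of (m, n) \<Rightarrow> c m n / of_nat (m + n) * z ^ m * w ^ n)) summable_on UNIV"
  proof (rule Infinite_Sum.abs_summable_on_comparison_test')
    fix p :: "nat \<times> nat"
    obtain m n where p: "p = (m, n)" by force
    have "norm (c m n) / real (m + n) \<le> norm (c m n)"
      by (cases "m + n = 0") (auto simp: divide_le_eq mult_le_cancel_left1 simp del: of_nat_add)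
    then have "norm (c m n) / real (m + n) * norm (z ^ m * w ^ n) \<le> norm (c m n) * norm (z ^ m * w ^ n)"
      by (rule mult_right_mono) simp
    moreover have "norm (of_nat (m + n) :: complex) = real (m + n)" by (rule norm_of_nat)
    ultimately show "norm (case p of (m, n) \<Rightarrow> c m n / of_nat (m + n) * z ^ m * w ^ n)
        \<le> norm (case p of (m, n) \<Rightarrow> c m n * z ^ m * w ^ n)"
      unfolding p by (simp add: norm_mult norm_divide mult.assoc del: of_nat_add)
  qed
  then have "(\<lambda>(m, n). c m n / of_nat (m + n) * z ^ m * w ^ n) summable_on UNIV"
    by (rule abs_summable_summable)
  moreover have "radial_int F (z, w) = (\<Sum>\<^sub>\<infinity>(m, n). c m n / of_nat (m + n) * z ^ m * w ^ n)"
    unfolding radial_int_def bidisc_series_coeff[OF assms] split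
    by (rule infsum_cong_neutral) auto
  ultimately show "((\<lambda>(m, n). c m n / of_nat (m + n) * z ^ m * w ^ n) has_sum radial_int F (z, w)) UNIV"
    by simp
qed

section \<open>Logarithmic integrals\<close>

text \<open>The gauge integral tolerates finitely many points without a derivative, which admits the
  singularity of the logarithm. Nonnegativity then turns the gauge integral into a Lebesgue
  integral.\<close>

lemma nonneg_FTC_lborel:
  fixes f F :: "real \<Rightarrow> real"
  assumes "finite S" "a \<le> b" "continuous_on {a..b} F"
    and der: "\<And>x. x \<in> {a<..<b} - S \<Longrightarrow> (F has_real_derivative f x) (at x)"
    and nonneg: "\<And>x. x \<in> {a..b} \<Longrightarrow> 0 \<le> f x"
    and meas[measurable]: "f \<in> borel_measurable borel"
  shows "set_integrable lborel {a..b} f" "(LBINT x:{a..b}. f x) = F b - F a"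
proof -
  have "(f has_integral (F b - F a)) {a..b}"
    using assms(1,2,3) der
    by (intro fundamental_theorem_of_calculus_interior_strong)
       (auto simp: has_real_derivative_iff_has_vector_derivative)
  then have I: "((\<lambda>x. if x \<in> {a..b} then f x else 0) has_integral (F b - F a)) UNIV"
    by (simp only: has_integral_restrict_UNIV)
  then have "0 \<le> F b - F a"
    by (rule has_integral_nonneg) (use nonneg in auto)
  moreover have nn: "(\<integral>\<^sup>+x. (if x \<in> {a..b} then f x else 0) \<partial>lborel) = ennreal (F b - F a)"
    by (rule nn_integral_has_integral_lborel[OF _ _ I]) (use nonneg in auto)
  ultimately have "has_bochner_integral lborel (\<lambda>x. if x \<in> {a..b} then f x else 0) (F b - F a)"
    by (intro has_bochner_integral_nn_integral) (use nonneg in auto)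
  moreover have "(\<lambda>x. if x \<in> {a..b} then f x else 0) = (\<lambda>x. indicator {a..b} x *\<^sub>R f x)"
    by (auto simp: indicator_def)
  ultimately show "set_integrable lborel {a..b} f" "(LBINT x:{a..b}. f x) = F b - F a"
    by (auto simp: set_integrable_def set_lebesgue_integral_def has_bochner_integral_iff)
qed

lemma continuous_on_x_ln_x: "continuous_on UNIV (\<lambda>x::real. x * ln \<bar>x\<bar>)"
  unfolding continuous_on_eq_continuous_within
proof
  fix x :: real
  show "isCont (\<lambda>x::real. x * ln \<bar>x\<bar>) x"
  proof (cases "x = 0")
    case True
    have "((\<lambda>x::real. x * ln \<bar>x\<bar>) \<longlongrightarrow> 0) (at_right 0)" by real_asymp
    moreover have "((\<lambda>x::real. x * ln \<bar>x\<bar>) \<longlongrightarrow> 0) (at_left 0)" by real_asymp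
    ultimately show ?thesis using True by (simp add: isCont_def filterlim_at_split)
  qed (auto intro!: continuous_intros)
qed

text \<open>Normalising by the largest modulus \<open>R\<close> on the interval makes the integrand
  nonnegative and the bound invariant under scaling. This is what makes the mean oscillation of the
  logarithm uniform in the arc.\<close>

lemma integral_ln_abs_ratio:
  fixes a b :: real
  assumes "a < b"
  defines "R \<equiv> max \<bar>a\<bar> \<bar>b\<bar>"
  shows "set_integrable lborel {a..b} (\<lambda>t. ln (R / \<bar>t\<bar>))"
    and "(LBINT t:{a..b}. ln (R / \<bar>t\<bar>)) \<le> 2 * (b - a)"
proof -
  have R: "0 < R" "\<bar>a\<bar> \<le> R" "\<bar>b\<bar> \<le> R" "R = \<bar>a\<bar> \<or> R = \<bar>b\<bar>" using assms by (auto simp: R_def max_def)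
  \<comment> \<open>For \<open>t\<close> nonzero this antiderivative equals
    \<open>t * (1 + ln (R / \<bar>t\<bar>))\<close>; it extends continuously through 0.\<close>
  define F where "F t = t * (1 + ln R) - t * ln \<bar>t\<bar>" for t
  have contF: "continuous_on {a..b} F"
    unfolding F_def by (intro continuous_intros continuous_on_subset[OF continuous_on_x_ln_x]) auto
  have der: "(F has_real_derivative ln (R / \<bar>t\<bar>)) (at t)" if t: "t \<in> {a<..<b} - {0}" for t
  proof -
    have "((\<lambda>t. ln \<bar>t\<bar>) has_real_derivative 1 / t) (at t)"
    proof (cases "t > 0")
      case True
      have "((\<lambda>t. ln t) has_real_derivative 1 / t) (at t)"
        using True by (auto intro!: derivative_eq_intros)
      then show ?thesis
        by (rule has_field_derivative_transform_within_open[of _ _ _ "{0<..}"]) (use True in auto)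
    next
      case False
      then have t0: "t < 0" using t by auto
      have "((\<lambda>t. ln (- t)) has_real_derivative 1 / t) (at t)"
        using t0 by (auto intro!: derivative_eq_intros simp: field_simps)
      then show ?thesis
        by (rule has_field_derivative_transform_within_open[of _ _ _ "{..<0}"]) (use t0 in auto)
    qed
    from DERIV_diff[OF DERIV_cmult_right[OF DERIV_ident, of "1 + ln R"] DERIV_mult[OF DERIV_ident this]]
    show ?thesis unfolding F_def using t R by (simp add: ln_div)
  qed
  \<comment> \<open>At \<open>t = 0\<close> the integrand is \<open>ln (R / 0) = ln 0 = 0\<close> by
    convention.\<close>
  have nonneg: "0 \<le> ln (R / \<bar>t\<bar>)" if "t \<in> {a..b}" for t
  proof (cases "t = 0")
    case False
    have "\<bar>t\<bar> \<le> R" using that unfolding R_def by auto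
    then show ?thesis using False by (intro ln_ge_zero) auto
  qed simp
  note ftc = nonneg_FTC_lborel[of "{0}", OF _ _ contF der nonneg]
  show "set_integrable lborel {a..b} (\<lambda>t. ln (R / \<bar>t\<bar>))"
    using assms by (intro ftc) auto
  \<comment> \<open>The upper bound \<open>R\<close> comes from \<open>ln x \<le> x - 1\<close>.
    With \<open>F R = R\<close> and \<open>F (- R) = - R\<close>, the endpoint of modulus
    \<open>R\<close> is fixed by \<open>F\<close>. If the other endpoint has the same sign, the
    difference \<open>F b - F a\<close> is at most \<open>b - a\<close>; otherwise it is at most
    \<open>2 * R\<close>, and \<open>R \<le> b - a\<close>.\<close>
  have G: "\<bar>t\<bar> \<le> \<bar>F t\<bar> \<and> \<bar>F t\<bar> \<le> R \<and> sgn (F t) = sgn t" if "\<bar>t\<bar> \<le> R" for t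
  proof (cases "t = 0")
    case False
    define q where "q = ln (R / \<bar>t\<bar>)"
    have F: "F t = t * (1 + q)" using False R by (simp add: F_def q_def ln_div algebra_simps)
    have "0 \<le> q" unfolding q_def using False that by (intro ln_ge_zero) auto
    moreover have "q \<le> R / \<bar>t\<bar> - 1" unfolding q_def using False R by (intro ln_le_minus_one) auto
    ultimately have "\<bar>t\<bar> * (1 + q) \<le> R" "\<bar>t\<bar> \<le> \<bar>t\<bar> * (1 + q)" using False by (auto simp: field_simps)
    then show ?thesis using \<open>0 \<le> q\<close> by (auto simp: F abs_mult sgn_mult)
  qed (use R in \<open>auto simp: F_def\<close>)
  have FR: "F R = R" "F (- R) = - R" using R by (auto simp: F_def algebra_simps)
  have "F b - F a \<le> 2 * (b - a)"
    using G[of a] G[of b] R assms(1) FR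
    by (auto simp: sgn_if abs_if split: if_splits)
  moreover have "(LBINT t:{a..b}. ln (R / \<bar>t\<bar>)) = F b - F a"
    using assms by (intro ftc) auto
  ultimately show "(LBINT t:{a..b}. ln (R / \<bar>t\<bar>)) \<le> 2 * (b - a)" by simp
qed

lemma norm_one_minus_cis: "norm (1 - cis t) = 2 * \<bar>sin (t / 2)\<bar>"
proof -
  have "(norm (1 - cis t))\<^sup>2 = (1 - cos t)\<^sup>2 + (sin t)\<^sup>2" by (simp add: cmod_power2)
  also have "\<dots> = 2 - 2 * cos t"
    using sin_cos_squared_add[of t] by (simp add: power2_eq_square algebra_simps)
  also have "\<dots> = (2 * \<bar>sin (t / 2)\<bar>)\<^sup>2"
    using cos_double_sin[of "t / 2"] by (simp add: power_mult_distrib)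
  finally show ?thesis using power2_eq_imp_eq by fastforce
qed

text \<open>The range is half of 3 pi / 2, the largest distance to the singularity that occurs
  below. The constant 1/5 is crude: up to pi/4 the derivative is at least cos (pi/4), and beyond it
  the sine is at least 6/10, while \<open>x / 5\<close> stays below 3/5.\<close>

lemma abs_sin_ge:
  fixes x :: real
  assumes "\<bar>x\<bar> \<le> 3 * pi / 4"
  shows "\<bar>sin x\<bar> \<ge> \<bar>x\<bar> / 5"
proof -
  have "sin x \<ge> x / 5" if "0 \<le> x" "x \<le> 3 * pi / 4" for x :: real
  proof (cases "x \<le> pi / 4")
    case True
    show ?thesis
    proof (cases "x = 0")
      case False
      then have "0 < x" using that by simp
      then obtain y where y: "0 < y" "y < x" "sin x - sin 0 = (x - 0) * cos y"
        using MVT2[of 0 x sin cos] by (auto intro: DERIV_sin)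
      have "cos y \<ge> cos (pi / 4)" using y True by (intro cos_monotone_0_pi_le) auto
      then have "cos y \<ge> 1 / 5"
        using real_le_rsqrt[of "2/5" 2] by (simp add: cos_45 power2_eq_square)
      then show ?thesis using y mult_left_mono[of "1/5" "cos y" x] by simp
    qed simp
  next
    case False
    have "cos \<bar>x - pi / 2\<bar> \<ge> cos (pi / 4)"
      using False that by (intro cos_monotone_0_pi_le) (auto simp: abs_if)
    moreover have "cos \<bar>x - pi / 2\<bar> = sin x"
      by (simp add: cos_diff)
    ultimately have "sin x \<ge> 6 / 10"
      using real_le_rsqrt[of "12/10" 2] by (simp add: cos_45 power2_eq_square)
    then show ?thesis using that pi_less_4 by simp
  qed
  from this[of x] this[of "- x"] show ?thesis using assms by (cases "x \<ge> 0") auto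
qed

section \<open>The logarithm is in BMOA\<close>

lemma set_integral_lborel_const:
  fixes c :: "'a :: {banach, second_countable_topology}"
  assumes "a \<le> b"
  shows "(LBINT t:{a..b}. c) = (b - a) *\<^sub>R c"
  unfolding set_lebesgue_integral_def using assms
  by (subst integral_scaleR_left) auto

lemma set_lborel_shift:
  fixes f :: "real \<Rightarrow> 'a :: {banach, second_countable_topology}"
  shows "set_integrable lborel {a..b} (\<lambda>t. f (t - s)) \<longleftrightarrow> set_integrable lborel {a - s..b - s} f"
    and "(LBINT t:{a..b}. f (t - s)) = (LBINT t:{a - s..b - s}. f t)"
proof -
  have *: "(\<lambda>t. indicator {a..b} t *\<^sub>R f (t - s)) =
      (\<lambda>t. (\<lambda>u. indicator {a - s..b - s} u *\<^sub>R f u) (- s + 1 * t))"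
    by (auto simp: indicator_def algebra_simps)
  show "set_integrable lborel {a..b} (\<lambda>t. f (t - s)) \<longleftrightarrow> set_integrable lborel {a - s..b - s} f"
    unfolding set_integrable_def * by (rule lborel_integrable_real_affine_iff) simp
  show "(LBINT t:{a..b}. f (t - s)) = (LBINT t:{a - s..b - s}. f t)"
    unfolding set_lebesgue_integral_def *
    by (subst (2) lborel_integral_real_affine[of 1 _ "- s"]) simp_all
qed

text \<open>These are the singular points of the boundary function; countability gives both
  measurability and a null exceptional set.\<close>

lemma countable_cis_eq_1: "countable {t. cis t = 1}"
proof (rule countable_subset)
  show "{t. cis t = 1} \<subseteq> range (\<lambda>n::int. of_int n * 2 * pi)"
    using cos_one_2pi_int by (auto simp: complex_eq_iff)
qed simp

text \<open>This keeps \<open>1 - cis t\<close> off the branch cut of \<open>Ln\<close>.\<close>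

lemma Re_one_minus_cis_pos: "cis t \<noteq> 1 \<Longrightarrow> 0 < Re (1 - cis t)"
proof -
  assume "cis t \<noteq> 1"
  then have "cos t \<noteq> 1" using cos_one_sin_zero[of t] by (auto simp: complex_eq_iff)
  then show ?thesis using cos_le_one[of t] by (simp add: less_le del: cos_le_one)
qed

lemma borel_measurable_Ln_one_minus_cis [measurable]:
  "(\<lambda>t. Ln (1 - cis t)) \<in> borel_measurable borel"
proof (rule borel_measurable_continuous_countable_exceptions[OF countable_cis_eq_1])
  show "continuous_on (- {t. cis t = 1}) (\<lambda>t. Ln (1 - cis t))"
    using Re_one_minus_cis_pos
    by (intro continuous_intros continuous_on_cis) (force simp: complex_nonpos_Reals_iff)
qed

text \<open>Since \<open>norm (1 - cis t)\<close> lies between \<open>\<bar>t\<bar> / 5\<close> and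
  \<open>\<bar>t\<bar>\<close>, the real part differs from \<open>ln (R / \<bar>t\<bar>)\<close> by
  at most \<open>ln 5\<close>. The imaginary part is an argument and costs at most pi.\<close>

lemma Ln_one_minus_cis_bound:
  assumes t: "\<bar>t\<bar> \<le> 3 * pi / 2" "t \<noteq> 0" and R: "\<bar>t\<bar> \<le> R"
  shows "norm (- Ln (1 - cis t) + of_real (ln R)) \<le> ln (R / \<bar>t\<bar>) + (ln 5 + pi)"
proof -
  define d where "d = norm (1 - cis t)"
  have "\<bar>t\<bar> / 5 \<le> d"
    using abs_sin_ge[of "t / 2"] t by (simp add: d_def norm_one_minus_cis)
  moreover have "d \<le> \<bar>t\<bar>"
    using abs_sin_x_le_abs_x[of "t / 2"] by (simp add: d_def norm_one_minus_cis)
  ultimately have d: "0 < d" "R / \<bar>t\<bar> \<le> R / d" "R / d \<le> 5 * (R / \<bar>t\<bar>)" "0 < R" "1 \<le> R / \<bar>t\<bar>"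
    using t R by (auto simp: field_simps intro: mult_left_mono)
  have ne: "1 - cis t \<noteq> 0" using d(1) by (auto simp: d_def)
  have "ln R - ln d = ln (R / d)" using d by (simp add: ln_div)
  moreover have "ln (R / \<bar>t\<bar>) \<le> ln (R / d)" using d t by (subst ln_le_cancel_iff) auto
  moreover have "ln (R / d) \<le> ln (5 * (R / \<bar>t\<bar>))" using d t by (subst ln_le_cancel_iff) auto
  moreover have "ln (5 * (R / \<bar>t\<bar>)) = ln 5 + ln (R / \<bar>t\<bar>)" using d t by (subst ln_mult) auto
  moreover have "0 \<le> ln (R / \<bar>t\<bar>)" using d(5) by simp
  ultimately have Re: "\<bar>Re (- Ln (1 - cis t) + of_real (ln R))\<bar> \<le> ln (R / \<bar>t\<bar>) + ln 5"
    using ne by (simp add: d_def)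
  have Im: "\<bar>Im (- Ln (1 - cis t) + of_real (ln R))\<bar> \<le> pi"
    using mpi_less_Im_Ln[OF ne] Im_Ln_le_pi[OF ne] by simp
  show ?thesis
    using cmod_le[of "- Ln (1 - cis t) + of_real (ln R)"] Re Im by linarith
qed

text \<open>After translation to the nearest singularity, the constant \<open>- ln R\<close>
  compares the function with \<open>ln (R / \<bar>t\<bar>)\<close>, whose integral is controlled by
  the length of the arc. The last conjunct bounds this constant on half circles, as needed for
  longer arcs.\<close>

lemma Ln_one_minus_cis_local_oscillation:
  assumes "a < b" "b \<le> a + pi"
  shows "\<exists>c. set_integrable lborel {a..b} (\<lambda>t. Ln (1 - cis t)) \<and>
    (LBINT t:{a..b}. norm (- Ln (1 - cis t) - c)) \<le> 10 * (b - a) \<and>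
    (b = a + pi \<longrightarrow> norm c \<le> 10)"
proof -
  \<comment> \<open>\<open>s\<close> is the multiple of 2 pi nearest to the midpoint of the arc,
    hence within pi of it. The half length adds at most pi/2, giving 3 pi / 2.\<close>
  define k :: int where "k = round ((a + b) / (4 * pi))"
  define s where "s = 2 * pi * of_int k"
  define R where "R = max \<bar>a - s\<bar> \<bar>b - s\<bar>"
  define w where "w t = ln (R / \<bar>t - s\<bar>) + (ln 5 + pi)" for t
  have "\<bar>of_int k - (a + b) / (4 * pi)\<bar> \<le> 1 / 2"
    unfolding k_def by (rule of_int_round_abs_le)
  then have "\<bar>s - (a + b) / 2\<bar> \<le> pi"
    by (simp add: s_def abs_le_iff field_simps)
  then have in_range: "\<bar>t - s\<bar> \<le> 3 * pi / 2" if "t \<in> {a..b}" for t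
    using that assms unfolding abs_le_iff by (auto simp: field_simps)
  have R: "R \<le> 3 * pi / 2" "0 < R"
    using in_range[of a] in_range[of b] assms unfolding R_def by auto
  have cis_shift: "cis (t - s) = cis t" for t
    by (simp add: s_def cis_mult[symmetric] flip: cis_divide)
  have bound: "norm (- Ln (1 - cis t) - (- of_real (ln R))) \<le> w t" if "t \<in> {a..b}" "t \<noteq> s" for t
    using Ln_one_minus_cis_bound[OF in_range[OF that(1)], of R] that
    by (auto simp: R_def w_def cis_shift)
  \<comment> \<open>At the singularity itself both logarithms take default values, so the pointwise
    bound is used only off this null set.\<close>
  have AEs: "AE t in lborel. t \<noteq> s" by (rule AE_lborel_singleton)
  have wi0: "set_integrable lborel {a..b} (\<lambda>t. ln (R / \<bar>t - s\<bar>))"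
    using integral_ln_abs_ratio(1)[of "a - s" "b - s"] assms
      set_lborel_shift(1)[of a b "\<lambda>t. ln (R / \<bar>t\<bar>)" s] by (simp add: R_def)
  have wi1: "set_integrable lborel {a..b} (\<lambda>t. ln 5 + pi)"
    by (intro borel_integrable_atLeastAtMost') auto
  have wi: "set_integrable lborel {a..b} w"
    unfolding w_def using wi0 wi1 by (rule set_integral_add)
  have "(LBINT t:{a..b}. w t) = (LBINT t:{a..b}. ln (R / \<bar>t - s\<bar>)) + (ln 5 + pi) * (b - a)"
    unfolding w_def using set_integral_add(2)[OF wi0 wi1] assms
    by (simp add: set_integral_lborel_const)
  also have "\<dots> \<le> 2 * (b - a) + (ln 5 + pi) * (b - a)"
    using integral_ln_abs_ratio(2)[of "a - s" "b - s"] assms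
      set_lborel_shift(2)[of a b "\<lambda>t. ln (R / \<bar>t\<bar>)" s] by (simp add: R_def)
  also have "\<dots> = (2 + ln 5 + pi) * (b - a)" by (simp add: algebra_simps)
  also have "\<dots> \<le> 10 * (b - a)"
  proof (rule mult_right_mono)
    show "2 + ln 5 + pi \<le> 10" using ln_le_minus_one[of 5] pi_less_4 by simp
  qed (use assms in simp)
  finally have w_le: "(LBINT t:{a..b}. w t) \<le> 10 * (b - a)" .
  have int: "set_integrable lborel {a..b} (\<lambda>t. - Ln (1 - cis t) - (- of_real (ln R)))"
  proof (rule set_integrable_bound[OF wi])
    show "AE t in lborel. t \<in> {a..b} \<longrightarrow> norm (- Ln (1 - cis t) - (- of_real (ln R))) \<le> norm (w t)"
      using AEs by eventually_elim (use bound in force)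
  qed (auto simp: set_borel_measurable_def)
  have "set_integrable lborel {a..b} (\<lambda>t. of_real (ln R) - (- Ln (1 - cis t) - (- of_real (ln R))))"
    by (rule set_integral_diff(1)[OF _ int]) (intro borel_integrable_atLeastAtMost' continuous_intros)
  then have int': "set_integrable lborel {a..b} (\<lambda>t. Ln (1 - cis t))" by simp
  have "(LBINT t:{a..b}. norm (- Ln (1 - cis t) - (- of_real (ln R)))) \<le> (LBINT t:{a..b}. w t)"
  proof (rule set_integral_mono_AE[OF set_integrable_norm[OF int] wi])
    show "AE t\<in>{a..b} in lborel. norm (- Ln (1 - cis t) - (- of_real (ln R))) \<le> w t"
      using AEs by eventually_elim (use bound in blast)
  qed
  moreover have "norm (- complex_of_real (ln R)) \<le> 10" if "b = a + pi"
  proof -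
    \<comment> \<open>An interval of length pi has an endpoint at distance at least pi/2 from
      \<open>s\<close>; with \<open>R \<le> 6\<close> this puts \<open>ln R\<close> between 0 and
      5.\<close>
    have "1 \<le> R" using that pi_ge_two unfolding R_def by (auto simp: max_def abs_if split: if_splits)
    moreover have "R \<le> 6" using R pi_less_4 by simp
    ultimately show ?thesis using ln_le_minus_one[of R] by (simp add: ln_ge_zero)
  qed
  ultimately show ?thesis
    using int' w_le by (intro exI[of _ "- of_real (ln R)"]) auto
qed

text \<open>On arcs longer than pi the constant 0 suffices: the integral of the modulus over a full
  period is at most 40 pi, which is below 40 times the length.\<close>

lemma Ln_one_minus_cis_oscillation:
  assumes "a < b" "b \<le> a + 2 * pi"
  shows "\<exists>c. set_integrable lborel {a..b} (\<lambda>t. Ln (1 - cis t)) \<and>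
    (LBINT t:{a..b}. norm (- Ln (1 - cis t) - c)) \<le> 40 * (b - a)"
proof (cases "b \<le> a + pi")
  case True
  then obtain c where "set_integrable lborel {a..b} (\<lambda>t. Ln (1 - cis t))"
    "(LBINT t:{a..b}. norm (- Ln (1 - cis t) - c)) \<le> 10 * (b - a)"
    using Ln_one_minus_cis_local_oscillation[of a b] assms by blast
  then show ?thesis using assms by (intro exI[of _ c]) auto
next
  case False
  \<comment> \<open>Over a half circle the oscillation about \<open>c\<close> contributes 10 pi and
    the constant \<open>c\<close>, of norm at most 10, another 10 pi.\<close>
  have half: "set_integrable lborel {x..x + pi} (\<lambda>t. Ln (1 - cis t)) \<and>
    (LBINT t:{x..x + pi}. norm (Ln (1 - cis t))) \<le> 20 * pi" for x
  proof -
    obtain c where c: "set_integrable lborel {x..x + pi} (\<lambda>t. Ln (1 - cis t))"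
      "(LBINT t:{x..x + pi}. norm (- Ln (1 - cis t) - c)) \<le> 10 * pi" "norm c \<le> 10"
      using Ln_one_minus_cis_local_oscillation[of x "x + pi"] by auto
    have const: "set_integrable lborel {x..x + pi} (\<lambda>t. norm c)"
      by (intro borel_integrable_atLeastAtMost') auto
    have constc: "set_integrable lborel {x..x + pi} (\<lambda>t. c)"
      by (intro borel_integrable_atLeastAtMost') auto
    have m: "set_integrable lborel {x..x + pi} (\<lambda>t. - Ln (1 - cis t))"
      using set_integrable_mult_right[of "-1" lborel "{x..x + pi}" "\<lambda>t. Ln (1 - cis t)"] c(1) by simp
    have d: "set_integrable lborel {x..x + pi} (\<lambda>t. norm (- Ln (1 - cis t) - c))"
      by (intro set_integrable_norm set_integral_diff m constc)
    have "(LBINT t:{x..x + pi}. norm (Ln (1 - cis t)))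
        \<le> (LBINT t:{x..x + pi}. norm (- Ln (1 - cis t) - c) + norm c)"
    proof (rule set_integral_mono[OF set_integrable_norm[OF c(1)] set_integral_add(1)[OF d const]])
      show "norm (Ln (1 - cis t)) \<le> norm (- Ln (1 - cis t) - c) + norm c" for t
        using norm_triangle_ineq[of "- Ln (1 - cis t) - c" c] by simp
    qed
    also have "\<dots> = (LBINT t:{x..x + pi}. norm (- Ln (1 - cis t) - c)) + norm c * pi"
      using set_integral_add(2)[OF d const] by (simp add: set_integral_lborel_const)
    also have "\<dots> \<le> 10 * pi + 10 * pi"
      using c by (intro add_mono mult_right_mono) auto
    finally show ?thesis using c(1) by simp
  qed
  have split: "{a..a + 2 * pi} = {a..a + pi} \<union> {a + pi..a + 2 * pi}" by auto
  have h1: "set_integrable lborel {a + pi..a + 2 * pi} (\<lambda>t. Ln (1 - cis t))"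
    and h2: "(LBINT t:{a + pi..a + 2 * pi}. norm (Ln (1 - cis t))) \<le> 20 * pi"
    using half[of "a + pi"] by (auto simp: algebra_simps)
  have int: "set_integrable lborel {a..a + 2 * pi} (\<lambda>t. Ln (1 - cis t))"
    unfolding split using half[of a] h1 by (intro set_integrable_Un) auto
  then have intb: "set_integrable lborel {a..b} (\<lambda>t. Ln (1 - cis t))"
    using assms by (elim set_integrable_subset) auto
  have "(LBINT t:{a..b}. norm (Ln (1 - cis t))) \<le> (LBINT t:{a..a + 2 * pi}. norm (Ln (1 - cis t)))"
    unfolding set_lebesgue_integral_def
    using int intb assms
    by (intro integral_mono) (auto simp: set_integrable_def indicator_def dest: integrable_norm)
  also have "\<dots> = (LBINT t:{a..a + pi}. norm (Ln (1 - cis t))) + (LBINT t:{a + pi..a + 2 * pi}. norm (Ln (1 - cis t)))"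
    unfolding split
  proof (rule set_integral_Un_AE)
    show "AE t in lborel. \<not> (t \<in> {a..a + pi} \<and> t \<in> {a + pi..a + 2 * pi})"
      using AE_lborel_singleton[of "a + pi"] by eventually_elim auto
  qed (use half[of a] h1 in \<open>auto intro: set_integrable_norm\<close>)
  also have "\<dots> \<le> 40 * pi" using half[of a] h2 by linarith
  also have "\<dots> \<le> 40 * (b - a)" using False by simp
  finally show ?thesis using intb by (intro exI[of _ 0]) simp
qed

text \<open>Replacing the mean by any other constant changes the oscillation by a factor of at most 2.\<close>

lemma mean_oscillation_le:
  assumes "a < b" and int: "set_integrable lborel {a..b} (\<lambda>t. \<phi> (cis t))"
    and D: "(LBINT t:{a..b}. norm (\<phi> (cis t) - c)) \<le> D * (b - a)"
  shows "(LBINT t:{a..b}. norm (\<phi> (cis t) - circle_mean \<phi> a b)) / (b - a) \<le> 2 * D"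
proof -
  let ?m = "circle_mean \<phi> a b"
  have const: "set_integrable lborel {a..b} (\<lambda>t. x)" for x :: "'a :: {banach, second_countable_topology}"
    by (intro borel_integrable_atLeastAtMost') auto
  have d: "set_integrable lborel {a..b} (\<lambda>t. \<phi> (cis t) - x)" for x
    by (intro set_integral_diff int const)
  \<comment> \<open>The mean minus \<open>c\<close> is the average of the function minus
    \<open>c\<close>, so its norm is at most \<open>D\<close>.\<close>
  have "(LBINT t:{a..b}. \<phi> (cis t) - c) = (LBINT t:{a..b}. \<phi> (cis t)) - (LBINT t:{a..b}. c)"
    by (rule set_integral_diff(2)[OF int const])
  also have "\<dots> = of_real (b - a) * (?m - c)"
    using \<open>a < b\<close>
    by (simp add: circle_mean_def set_integral_lborel_const right_diff_distrib scaleR_conv_of_real del: of_real_diff)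
  finally have "(b - a) * norm (?m - c) = norm (LBINT t:{a..b}. \<phi> (cis t) - c)"
    using \<open>a < b\<close> by (simp add: norm_mult del: of_real_diff)
  also have "\<dots> \<le> D * (b - a)"
    using set_integral_norm_bound[OF d[of c]] D by linarith
  finally have m: "(b - a) * norm (c - ?m) \<le> D * (b - a)" by (simp add: norm_minus_commute)
  have "(LBINT t:{a..b}. norm (\<phi> (cis t) - ?m)) \<le> (LBINT t:{a..b}. norm (\<phi> (cis t) - c) + norm (c - ?m))"
  proof (rule set_integral_mono[OF set_integrable_norm[OF d] set_integral_add(1)[OF set_integrable_norm[OF d] const]])
    show "norm (\<phi> (cis t) - ?m) \<le> norm (\<phi> (cis t) - c) + norm (c - ?m)" for t
      using norm_triangle_ineq[of "\<phi> (cis t) - c" "c - ?m"] by simp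
  qed
  also have "\<dots> = (LBINT t:{a..b}. norm (\<phi> (cis t) - c)) + (b - a) * norm (c - ?m)"
    using set_integral_add(2)[OF set_integrable_norm[OF d] const, of c "norm (c - ?m)"] \<open>a < b\<close> by (simp add: set_integral_lborel_const)
  also have "\<dots> \<le> 2 * D * (b - a)" using m D by linarith
  finally show ?thesis using \<open>a < b\<close> by (simp add: divide_le_eq)
qed

lemma log_bmo_circle: "(\<lambda>z. - Ln (1 - z)) \<in> bmo_circle"
proof -
  have int: "set_integrable lborel {a..b} (\<lambda>t. - Ln (1 - cis t))" if "a < b" "b \<le> a + 2 * pi" for a b
    using Ln_one_minus_cis_oscillation[OF that]
      set_integrable_mult_right[of "-1" lborel "{a..b}" "\<lambda>t. Ln (1 - cis t)"] by auto
  have "(LBINT t:{a..b}. norm (- Ln (1 - cis t) - circle_mean (\<lambda>z. - Ln (1 - z)) a b)) / (b - a) \<le> 2 * 40"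
    if ab: "a < b" "b \<le> a + 2 * pi" for a b
  proof -
    obtain c where "(LBINT t:{a..b}. norm (- Ln (1 - cis t) - c)) \<le> 40 * (b - a)"
      using Ln_one_minus_cis_oscillation[OF ab] by blast
    then show ?thesis
      using mean_oscillation_le[of a b "\<lambda>z. - Ln (1 - z)" c 40] int[OF ab] ab by simp
  qed
  then show ?thesis using int[of 0 "2 * pi"] by (auto simp: bmo_circle_def)
qed

text \<open>The convention \<open>1 / 0 = 0\<close> supplies the correct constant term.\<close>

lemma disc_series_log: "disc_series (\<lambda>n. 1 / of_nat n) (\<lambda>z. - Ln (1 - z))"
  unfolding disc_series_def
proof
  fix z :: complex assume "z \<in> unit_disc"
  then show "(\<lambda>n. 1 / of_nat n * z ^ n) sums - Ln (1 - z)"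
    using sums_minus[OF Ln_series'[of "- z"]] by simp
qed

text \<open>The squared coefficients are \<open>1 / n^2\<close>, and the radial limits follow from
  continuity of \<open>Ln\<close> off its branch cut, so only the points with
  \<open>cis t = 1\<close> are excluded.\<close>

lemma log_bmoa_disc: "(\<lambda>z. - Ln (1 - z)) \<in> bmoa_disc"
proof -
  have "summable (\<lambda>n. (norm ((deriv ^^ n) (\<lambda>z. - Ln (1 - z)) 0 / fact n))\<^sup>2)"
    using inverse_power_summable[of 2, where 'a = real]
    by (simp add: disc_series_coeff[OF disc_series_log] norm_divide power_divide field_simps del: norm_fact)
  moreover have "AE t in lborel. ((\<lambda>r. - Ln (1 - of_real r * cis t)) \<longlongrightarrow> - Ln (1 - cis t)) (at_left 1)"
  proof (rule AE_mp[OF AE_not_in AE_I2])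
    show "{t. cis t = 1} \<in> null_sets lborel"
      by (rule countable_imp_null_set_lborel[OF countable_cis_eq_1])
    fix t show "t \<notin> {t. cis t = 1} \<longrightarrow>
      ((\<lambda>r. - Ln (1 - of_real r * cis t)) \<longlongrightarrow> - Ln (1 - cis t)) (at_left 1)"
    proof
      assume "t \<notin> {t. cis t = 1}"
      then have "1 - cis t \<notin> \<real>\<^sub>\<le>\<^sub>0" using Re_one_minus_cis_pos[of t] by (auto simp: complex_nonpos_Reals_iff)
      moreover have "((\<lambda>r. 1 - of_real r * cis t) \<longlongrightarrow> 1 - of_real 1 * cis t) (at_left 1)"
        by (intro tendsto_intros)
      ultimately show "((\<lambda>r. - Ln (1 - of_real r * cis t)) \<longlongrightarrow> - Ln (1 - cis t)) (at_left 1)"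
        by (intro tendsto_minus tendsto_Ln) auto
    qed
  qed
  ultimately show ?thesis
    using log_bmo_circle disc_series_holomorphic[OF disc_series_log]
    by (auto simp: bmoa_disc_def hardy2_disc_def)
qed

section \<open>The lower bound for the radial Volterra operator\<close>

text \<open>The product rule splits \<open>R (g1 \<otimes> g2)\<close> into two tensor products, and
  a test function of \<open>w\<close> alone preserves this form. Hence only \<open>a m\<close>
  enters the coefficient of \<open>z ^ m\<close>, and the two Cauchy products in \<open>w\<close>
  combine into the weight \<open>m + (n - i)\<close>.\<close>

lemma radial_volterra_tensor_coeff:
  assumes a: "disc_series a g1" and b: "disc_series b g2" and p: "disc_series p h"
  shows "taylor_coeff2 (radial_volterra (g1 \<otimes>\<^sub>f g2) ((\<lambda>_. 1) \<otimes>\<^sub>f h)) m n =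
    a m * (\<Sum>i\<le>n. p i * (of_nat (m + (n - i)) * b (n - i))) / of_nat (m + n)"
proof -
  let ?c = "\<lambda>m n. of_nat m * a m * (\<Sum>i\<le>n. p i * b (n - i)) +
    a m * (\<Sum>i\<le>n. p i * (of_nat (n - i) * b (n - i)))"
  have "bidisc_series ?c (\<lambda>q. ((\<lambda>z. z * deriv g1 z) \<otimes>\<^sub>f (\<lambda>w. h w * g2 w)) q
      + (g1 \<otimes>\<^sub>f (\<lambda>w. h w * (w * deriv g2 w))) q)"
    by (intro bidisc_series_add bidisc_series_tensor disc_series_mult disc_series_euler a b p)
  then have "bidisc_series ?c (\<lambda>q. ((\<lambda>_. 1) \<otimes>\<^sub>f h) q * radial_diff (g1 \<otimes>\<^sub>f g2) q)"
  proof (rule bidisc_series_cong)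
    fix q assume "q \<in> bidisc"
    then obtain z w where q: "q = (z, w)" "z \<in> unit_disc" "w \<in> unit_disc" by auto
    have "g1 field_differentiable at z" "g2 field_differentiable at w"
      using q disc_series_holomorphic[OF a] disc_series_holomorphic[OF b]
      by (auto intro: holomorphic_on_imp_differentiable_at)
    then have "deriv (\<lambda>u. g1 u * g2 w) z = deriv g1 z * g2 w"
      and "deriv (\<lambda>v. g1 z * g2 v) w = g1 z * deriv g2 w"
      by (auto intro: deriv_cmult_right deriv_cmult)
    then show "((\<lambda>z. z * deriv g1 z) \<otimes>\<^sub>f (\<lambda>w. h w * g2 w)) q + (g1 \<otimes>\<^sub>f (\<lambda>w. h w * (w * deriv g2 w))) q
        = ((\<lambda>_. 1) \<otimes>\<^sub>f h) q * radial_diff (g1 \<otimes>\<^sub>f g2) q"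
      by (simp add: q tensor_fun_def radial_diff_def algebra_simps)
  qed
  moreover have "?c m n = a m * (\<Sum>i\<le>n. p i * (of_nat (m + (n - i)) * b (n - i)))"
    unfolding sum_distrib_left sum.distrib[symmetric] of_nat_add
    by (intro sum.cong refl) (simp only: distrib_left distrib_right mult_ac)
  ultimately show ?thesis
    using bidisc_series_coeff[OF bidisc_series_radial_int, of ?c _ m n]
    by (simp only: radial_volterra_def)
qed

section \<open>Test functions with all coefficients equal to 1, and the harmonic numbers they
  produce\<close>

definition geometric_poly :: "nat \<Rightarrow> complex \<Rightarrow> complex" where
  "geometric_poly N w = (\<Sum>i<N. w ^ i)"

lemma disc_series_geometric_poly:
  "disc_series (\<lambda>n. if n < N then 1 else 0) (geometric_poly N)"
  unfolding disc_series_def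
proof
  fix w :: complex
  have "(\<lambda>n. (if n < N then 1 else 0) * w ^ n) sums (\<Sum>n<N. (if n < N then 1 else 0) * w ^ n)"
    by (rule sums_finite) auto
  then show "(\<lambda>n. (if n < N then 1 else 0) * w ^ n) sums geometric_poly N w"
    by (simp add: geometric_poly_def)
qed

lemma taylor_coeff2_geometric_poly:
  "taylor_coeff2 ((\<lambda>_. 1) \<otimes>\<^sub>f geometric_poly N) m n = (if m = 0 \<and> n < N then 1 else 0)"
proof -
  have "disc_series (\<lambda>n. if n < 1 then 1 else 0) (\<lambda>_. 1)"
    using disc_series_geometric_poly[of 1] by (simp add: geometric_poly_def[abs_def])
  from bidisc_series_coeff[OF bidisc_series_tensor[OF this disc_series_geometric_poly[of N]], of m n]
  show ?thesis by simp
qed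

lemma geometric_poly_hardy2:
  "(\<lambda>_. 1) \<otimes>\<^sub>f geometric_poly N \<in> hardy2_bidisc"
  "hardy2_bidisc_norm ((\<lambda>_. 1) \<otimes>\<^sub>f geometric_poly N) = sqrt (real N)"
proof -
  let ?q = "\<lambda>(m, n). (norm (taylor_coeff2 ((\<lambda>_. 1) \<otimes>\<^sub>f geometric_poly N) m n))\<^sup>2"
  have "(?q has_sum (\<Sum>x\<in>{0} \<times> {..<N}. ?q x)) UNIV"
    by (rule has_sum_finite_neutralI) (auto simp: taylor_coeff2_geometric_poly split: if_splits)
  moreover have "(\<Sum>x\<in>{0} \<times> {..<N}. ?q x) = (\<Sum>x\<in>{0::nat} \<times> {..<N}. 1)"
    by (intro sum.cong) (auto simp: taylor_coeff2_geometric_poly)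
  ultimately have q: "(?q has_sum real N) UNIV" by simp
  show "hardy2_bidisc_norm ((\<lambda>_. 1) \<otimes>\<^sub>f geometric_poly N) = sqrt (real N)"
    unfolding hardy2_bidisc_norm_def using infsumI[OF q] by simp
  have "holomorphic_bidisc ((\<lambda>_. 1) \<otimes>\<^sub>f geometric_poly N)"
    unfolding holomorphic_bidisc_def
  proof
    fix p :: "complex \<times> complex"
    have "(geometric_poly N has_field_derivative (\<Sum>i<N. of_nat i * snd p ^ (i - 1))) (at (snd p))"
      unfolding geometric_poly_def[abs_def] by (auto intro!: derivative_eq_intros)
    then have "((\<lambda>x. geometric_poly N (snd x)) has_derivative
        (\<lambda>x. (\<Sum>i<N. of_nat i * snd p ^ (i - 1)) * snd x)) (at p)"
      unfolding has_field_derivative_def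
      by (rule has_derivative_compose[OF has_derivative_snd[OF has_derivative_ident]])
    then have "(((\<lambda>_. 1) \<otimes>\<^sub>f geometric_poly N) has_derivative
        (\<lambda>(h, k). 0 * h + (\<Sum>i<N. of_nat i * snd p ^ (i - 1)) * k)) (at p)"
      by (simp add: tensor_fun_def case_prod_unfold)
    then show "\<exists>a b. (((\<lambda>_. 1) \<otimes>\<^sub>f geometric_poly N) has_derivative (\<lambda>(h, k). a * h + b * k)) (at p)"
      by blast
  qed
  then show "(\<lambda>_. 1) \<otimes>\<^sub>f geometric_poly N \<in> hardy2_bidisc"
    using has_sum_imp_summable[OF q] by (simp add: hardy2_bidisc_def)
qed

lemma radial_volterra_log_coeff_ge:
  fixes a :: "nat \<Rightarrow> real"
  assumes a: "disc_series (\<lambda>m. of_real (a m)) g1" and "0 \<le> a m" "n < m"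
  shows "norm (taylor_coeff2 (radial_volterra (g1 \<otimes>\<^sub>f (\<lambda>w. - Ln (1 - w))) ((\<lambda>_. 1) \<otimes>\<^sub>f geometric_poly m)) m n)
    \<ge> a m * harm n / 2"
proof -
  define S where "S = (\<Sum>j\<le>n. real (m + j) / real j)"
  \<comment> \<open>As \<open>n < m\<close>, the truncation of the test polynomial is invisible in
    this coefficient.\<close>
  have "(\<Sum>i\<le>n. (if i < m then 1 else 0) * (of_nat (m + (n - i)) * (1 / of_nat (n - i))))
      = (\<Sum>i\<le>n. complex_of_real (real (m + (n - i)) / real (n - i)))"
    using assms(3) by (intro sum.cong) auto
  also have "\<dots> = (\<Sum>j\<le>n. complex_of_real (real (m + j) / real j))"
    by (rule sum.reindex_bij_witness[of _ "\<lambda>j. n - j" "\<lambda>i. n - i"]) auto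
  also have "\<dots> = of_real S" by (simp add: S_def)
  finally have coeff: "taylor_coeff2 (radial_volterra (g1 \<otimes>\<^sub>f (\<lambda>w. - Ln (1 - w)))
      ((\<lambda>_. 1) \<otimes>\<^sub>f geometric_poly m)) m n = of_real (a m * S / real (m + n))"
    using radial_volterra_tensor_coeff[OF a disc_series_log disc_series_geometric_poly[of m], of m n]
    by simp
  have "m * harm n = (\<Sum>j=1..n. real m / real j)"
    by (simp add: harm_def sum_distrib_left divide_inverse)
  also have "\<dots> \<le> (\<Sum>j=1..n. real (m + j) / real j)"
    by (intro sum_mono divide_right_mono) auto
  \<comment> \<open>The extra term \<open>j = 0\<close> is a division by zero and contributes
    0.\<close>
  also have "\<dots> = S" unfolding S_def by (rule sum.mono_neutral_left) auto
  finally have S: "m * harm n \<le> S" .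
  \<comment> \<open>Here \<open>n < m\<close> is used again: \<open>m + n \<le> 2 * m\<close>, the
    source of the factor 1/2.\<close>
  have "harm n / 2 * real (m + n) \<le> harm n / 2 * (2 * real m)"
    using assms(3) harm_nonneg[of n, where 'a = real] by (intro mult_left_mono) auto
  then have "harm n / 2 \<le> S / real (m + n)"
    using S assms(3) by (simp add: field_simps)
  then have "a m * (harm n / 2) \<le> a m * (S / real (m + n))"
    using assms(2) by (rule mult_left_mono)
  then have "a m * harm n / 2 \<le> a m * S / real (m + n)" by (simp only: times_divide_eq_right)
  also have "\<dots> \<le> \<bar>a m * S / real (m + n)\<bar>" by (rule abs_ge_self)
  finally show ?thesis unfolding coeff norm_of_real .
qed

section \<open>The bounded lacunary symbol\<close>

definition gap_exponent :: "nat \<Rightarrow> nat" where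
  "gap_exponent k = 2 * 2 ^ (4 ^ k)"

text \<open>The lacunary series is spread out over all exponents, with zeros in the gaps, so that it
  is an ordinary power series.\<close>

definition gap_coeff :: "nat \<Rightarrow> real" where
  "gap_coeff m = (if m \<in> range gap_exponent then (1 / 2) ^ inv gap_exponent m else 0)"

lemma inj_gap_exponent: "inj gap_exponent"
  by (rule injI) (simp add: gap_exponent_def)

lemma gap_coeff_gap_exponent: "gap_coeff (gap_exponent k) = (1 / 2) ^ k"
  by (simp add: gap_coeff_def inv_f_f[OF inj_gap_exponent])

lemma gap_coeff_nonneg: "0 \<le> gap_coeff m"
  by (simp add: gap_coeff_def)

text \<open>Reindexing along the injective exponents reduces this to a geometric series. Absolute
  summability of the coefficients is also what bounds the symbol.\<close>

lemma summable_gap_coeff: "summable gap_coeff"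
proof -
  have "(\<lambda>k. (1 / 2) ^ k :: real) summable_on UNIV"
    by (subst summable_on_UNIV_nonneg_real_iff) (auto intro: summable_geometric)
  then have "(gap_coeff \<circ> gap_exponent) summable_on UNIV"
    by (simp add: o_def gap_coeff_gap_exponent)
  then have "gap_coeff summable_on range gap_exponent"
    using summable_on_reindex[OF inj_gap_exponent, of gap_coeff] by simp
  then have "gap_coeff summable_on UNIV"
    by (rule summable_on_cong_neutral[THEN iffD1, rotated -1]) (auto simp: gap_coeff_def)
  then show ?thesis
    by (simp add: summable_on_UNIV_nonneg_real_iff gap_coeff_nonneg)
qed

definition gap_series :: "complex \<Rightarrow> complex" where
  "gap_series z = (\<Sum>m. of_real (gap_coeff m) * z ^ m)"

lemma gap_term_le:
  assumes "z \<in> unit_disc"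
  shows "norm (of_real (gap_coeff m) * z ^ m) \<le> gap_coeff m"
  using assms gap_coeff_nonneg[of m] power_le_one[of "norm z" m]
  by (simp add: norm_mult norm_power mult_left_le)

lemma disc_series_gap_series: "disc_series (\<lambda>m. of_real (gap_coeff m)) gap_series"
  unfolding disc_series_def gap_series_def
proof
  fix z :: complex assume "z \<in> unit_disc"
  then have "summable (\<lambda>m. of_real (gap_coeff m) * z ^ m)"
    using gap_term_le by (intro summable_comparison_test'[OF summable_gap_coeff]) auto
  then show "(\<lambda>m. of_real (gap_coeff m) * z ^ m) sums (\<Sum>m. of_real (gap_coeff m) * z ^ m)"
    by (rule summable_sums)
qed

lemma gap_series_hardy_inf: "gap_series \<in> hardy_inf_disc"
proof -
  have "norm (gap_series z) \<le> suminf gap_coeff" if "z \<in> unit_disc" for z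
    unfolding gap_series_def using gap_term_le[OF that] summable_gap_coeff by (intro norm_suminf_le)
  then have "bounded (gap_series ` unit_disc)" by (auto intro!: boundedI)
  then show ?thesis using disc_series_holomorphic[OF disc_series_gap_series] by (simp add: hardy_inf_disc_def)
qed

section \<open>Growth of the operator norm along the gap exponents\<close>

theorem theorem6p6:
  "\<exists>g1\<in>hardy_inf_disc. \<exists>g2\<in>bmoa_disc.
     \<not> bounded_on_hardy2_bidisc (radial_volterra (g1 \<otimes>\<^sub>f g2))"
proof (intro bexI notI)
  let ?g2 = "\<lambda>w. - Ln (1 - w)"
  let ?T = "radial_volterra (gap_series \<otimes>\<^sub>f ?g2)"
  assume bdd: "bounded_on_hardy2_bidisc ?T"
  then obtain C where C: "\<And>f. f \<in> hardy2_bidisc \<Longrightarrow> hardy2_bidisc_norm (?T f) \<le> C * hardy2_bidisc_norm f"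
    and T: "\<And>f. f \<in> hardy2_bidisc \<Longrightarrow> ?T f \<in> hardy2_bidisc"
    unfolding bounded_on_hardy2_bidisc_def by blast
  \<comment> \<open>Testing at level \<open>k\<close> gives
    \<open>2 ^ k / 4 \<le> L \<le> 2 * C\<close>, which is impossible for large
    \<open>k\<close>.\<close>
  have "2 ^ k \<le> 8 * C" for k :: nat
  proof -
    \<comment> \<open>\<open>K\<close> is half of \<open>N\<close>: the \<open>K\<close> indices
      \<open>n\<close> from \<open>K\<close> to \<open>N - 1\<close> all satisfy
      \<open>harm K \<le> harm n\<close>, so \<open>L\<close> is a common lower bound for their
      coefficients.\<close>
    define K :: nat where "K = 2 ^ (4 ^ k)"
    define N where "N = gap_exponent k"
    define f where "f = (\<lambda>_. 1) \<otimes>\<^sub>f geometric_poly N"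
    define L where "L = (1 / 2) ^ k * harm K / (2 :: real)"
    have N: "N = 2 * K" "0 < K" by (simp_all add: N_def K_def gap_exponent_def)
    have L: "0 \<le> L" by (simp add: L_def harm_nonneg)
    have f: "f \<in> hardy2_bidisc" "hardy2_bidisc_norm f = sqrt (real N)"
      unfolding f_def by (rule geometric_poly_hardy2)+
    let ?q = "\<lambda>(m, n). (norm (taylor_coeff2 (?T f) m n))\<^sup>2"
    have q: "L\<^sup>2 \<le> ?q x" if "x \<in> {N} \<times> {K..<N}" for x
    proof -
      obtain n where n: "x = (N, n)" "K \<le> n" "n < N" using \<open>x \<in> {N} \<times> {K..<N}\<close> by auto
      have "L \<le> gap_coeff N * harm n / 2"
        unfolding L_def N_def gap_coeff_gap_exponent
        using harm_mono[OF n(2), where 'a = real] by (intro divide_right_mono mult_left_mono) auto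
      also have "\<dots> \<le> norm (taylor_coeff2 (?T f) N n)"
        unfolding f_def using n(3)
        by (rule radial_volterra_log_coeff_ge[OF disc_series_gap_series gap_coeff_nonneg])
      finally show ?thesis using L by (simp add: n power_mono)
    qed
    \<comment> \<open>Keeping only these \<open>K\<close> coefficients bounds the norm of the image
      from below. The norm of \<open>f\<close> is \<open>sqrt (2 * K)\<close>, so
      \<open>sqrt K\<close> cancels.\<close>
    have "real K * L\<^sup>2 = (\<Sum>x\<in>{N} \<times> {K..<N}. L\<^sup>2)" using N by simp
    also have "\<dots> \<le> (\<Sum>x\<in>{N} \<times> {K..<N}. ?q x)" by (intro sum_mono q)
    also have "\<dots> \<le> infsum ?q UNIV"
      using T[OF f(1)] by (intro finite_sum_le_infsum) (auto simp: hardy2_bidisc_def)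
    finally have "sqrt (real K * L\<^sup>2) \<le> hardy2_bidisc_norm (?T f)"
      unfolding hardy2_bidisc_norm_def by (rule real_sqrt_le_mono)
    also have "\<dots> \<le> C * sqrt (real N)" using C[OF f(1)] f(2) by simp
    finally have "sqrt (real K) * L \<le> sqrt (real K) * (sqrt 2 * C)"
      using L N by (simp add: real_sqrt_mult mult_ac)
    then have LC: "L \<le> sqrt 2 * C" using N by simp
    then have "0 \<le> C" using L by (metis order_trans mult_le_0_iff not_le real_sqrt_gt_0_iff zero_less_numeral mult_pos_neg)
    moreover have "sqrt 2 \<le> (2::real)" by (rule real_le_lsqrt) auto
    ultimately have "L \<le> 2 * C" using LC mult_right_mono[of "sqrt 2" 2 C] by linarith
    \<comment> \<open>The double exponential makes \<open>ln K\<close> equal to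
      \<open>4 ^ k * ln 2\<close>, which outgrows the factor \<open>2 ^ k\<close> lost to the
      coefficient of the symbol.\<close>
    have "4 ^ k * (1 / 2) \<le> 4 ^ k * ln (2::real)"
      using ln2_ge_two_thirds by (intro mult_left_mono) auto
    also have "\<dots> = ln (real K)" by (simp add: K_def ln_realpow)
    also have "\<dots> \<le> ln (real K + 1)" using N by simp
    also have "\<dots> \<le> harm K" by (rule ln_le_harm)
    finally have "(1 / 2) ^ k * (4 ^ k * (1 / 2)) / 2 \<le> L"
      unfolding L_def by (intro divide_right_mono mult_left_mono) auto
    moreover have "(1 / 2) ^ k * 4 ^ k = (2 ^ k :: real)"
      by (simp flip: power_mult_distrib)
    ultimately show ?thesis using \<open>L \<le> 2 * C\<close> by simp
  qed
  moreover obtain k where "8 * C < 2 ^ k"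
    using real_arch_pow[of 2 "8 * C"] by auto
  ultimately show False by (meson not_le)
next
  show "(\<lambda>w. - Ln (1 - w)) \<in> bmoa_disc" by (rule log_bmoa_disc)
  show "gap_series \<in> hardy_inf_disc" by (rule gap_series_hardy_inf)
qed

end
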